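(* Let $\Gamma$ be a bipartite strongly distance-balanced graph that is not a cycle. Then $\Gamma$ is $3$-connected.
   Context: All graphs are finite, simple, undirected, connected; $d$ denotes distance and $N_i(u)=\{v: d(u,v)=i\}$. A graph is strongly distance-balanced if for every pair of adjacent vertices $u,v$ and every integer $i\ge0$, $|N_i(u)\cap N_{i+1}(v)|=|N_{i+1}(u)\cap N_i(v)|$. A graph is $3$-connected if it has at least $4$ vertices and removing any at most $2$ vertices leaves it connected.
   Formalization: The graph is additionally assumed to have at least 3 vertices; this excludes only the one-vertex graph and the single edge, which are bipartite, strongly distance-balanced and not cycles but have fewer than 4 vertices and so are not 3-connected. *)

theory Defs
  imports "Graph_Theory.Graph_Theory"
begin

text \<open>A finite simple undirected graph is an instance of the locale \<^locale>\<open>graph\<close>: a finite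
  loop-free digraph without parallel arcs whose arc relation is symmetric, so that each undirected
  edge is represented by a pair of opposite arcs.\<close>

definition graph_dist :: "('a, 'b) pre_digraph \<Rightarrow> 'a \<Rightarrow> 'a \<Rightarrow> ereal" where
  "graph_dist G u v = wf_digraph.\<mu> G (\<lambda>_. 1) u v"

definition dist_sphere :: "('a, 'b) pre_digraph \<Rightarrow> nat \<Rightarrow> 'a \<Rightarrow> 'a set" where
  "dist_sphere G i u = {v \<in> verts G. graph_dist G u v = ereal (real i)}"

definition strongly_distance_balanced :: "('a, 'b) pre_digraph \<Rightarrow> bool" where
  "strongly_distance_balanced G \<longleftrightarrow>
     (\<forall>u v. u \<rightarrow>\<^bsub>G\<^esub> v \<longrightarrow>
       (\<forall>i. card (dist_sphere G i u \<inter> dist_sphere G (i + 1) v) =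
            card (dist_sphere G (i + 1) u \<inter> dist_sphere G i v)))"

definition bipartite :: "('a, 'b) pre_digraph \<Rightarrow> bool" where
  "bipartite G \<longleftrightarrow>
     (\<exists>A B. A \<union> B = verts G \<and> A \<inter> B = {} \<and>
       (\<forall>u v. u \<rightarrow>\<^bsub>G\<^esub> v \<longrightarrow> u \<in> A \<and> v \<in> B \<or> u \<in> B \<and> v \<in> A))"

definition cycle_graph :: "nat \<Rightarrow> nat pair_pre_digraph" where
  "cycle_graph n =
     \<lparr>pverts = {..<n},
      parcs = {(i, j). i < n \<and> j < n \<and> (j = (i + 1) mod n \<or> i = (j + 1) mod n)}\<rparr>"

text \<open>The bound \<open>n \<ge> 3\<close> excludes the degenerate cases, where \<^const>\<open>cycle_graph\<close> has a loop
  (\<open>n = 1\<close>) or is a single edge (\<open>n = 2\<close>).\<close>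
definition is_cycle_graph :: "('a, 'b) pre_digraph \<Rightarrow> bool" where
  "is_cycle_graph G \<longleftrightarrow> (\<exists>n\<ge>3. digraph_iso (with_proj (cycle_graph n)) G)"

definition three_connected :: "('a, 'b) pre_digraph \<Rightarrow> bool" where
  "three_connected G \<longleftrightarrow>
     card (verts G) \<ge> 4 \<and>
     (\<forall>S \<subseteq> verts G. card S \<le> 2 \<longrightarrow> Digraph_Component.connected (G \<restriction> (verts G - S)))"

end

theory Submission
  imports Defs
begin

text \<open>In a bipartite strongly distance-balanced graph all vertices have the same degree and the same
  eccentricity \<open>D\<close>; degree 2 means a cycle, so let the degree be at least 3. Suppose \<open>{x, y}\<close>
  separates \<open>A\<close> from \<open>B\<close> with \<open>|A| \<le> |B|\<close>, and let \<open>n = d(x, y)\<close>. Comparing the two sides of an edge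
  between \<open>x\<close> and \<open>A\<close> shows that every neighbour of \<open>x\<close> in \<open>A\<close> is closer to \<open>y\<close> than \<open>x\<close> is, and
  that some neighbour of \<open>y\<close> in \<open>B\<close> is farther from \<open>x\<close> than \<open>y\<close> is (and the same with \<open>x\<close>, \<open>y\<close>
  exchanged). Hence a vertex \<open>z\<close> at distance \<open>D\<close> from \<open>y\<close> lies in \<open>B\<close> with \<open>d(y, z) = n + d(x, z)\<close>,
  which forces \<open>d(x, w) \<le> n\<close> for all \<open>w\<close> in \<open>A\<close>. Write \<open>A\<^sub>i\<close>, \<open>B\<^sub>i\<close> for the vertices of \<open>A\<close>, \<open>B\<close> at
  distance \<open>i\<close> from \<open>x\<close>. The balance condition at an edge from \<open>x\<close> into \<open>B\<close> leading away from \<open>y\<close>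
  and at an edge from \<open>x\<close> into \<open>A\<close> gives that \<open>|A\<^sub>n\<^sub>-\<^sub>1| \<le> |B\<^sub>n|\<close> is less than the degree, so \<open>A\<^sub>n\<close>, all
  of whose neighbours would lie in \<open>A\<^sub>n\<^sub>-\<^sub>1\<close>, is empty; then \<open>|A\<^sub>n\<^sub>-\<^sub>2| \<le> |B\<^sub>n\<^sub>-\<^sub>1| \<le> 1\<close>. So a
  neighbour of \<open>y\<close> in \<open>A\<close> has at most two neighbours, a contradiction.\<close>

section \<open>Balanced bipartite graph metrics\<close>

text \<open>Two vertices are adjacent iff their distance is 1.\<close>
locale balanced_bipartite_metric =
  fixes V :: "'a set" and d :: "'a \<Rightarrow> 'a \<Rightarrow> nat"
  assumes finite_V: "finite V"
    and dist_eq_0_iff: "\<lbrakk>u \<in> V; v \<in> V\<rbrakk> \<Longrightarrow> d u v = 0 \<longleftrightarrow> u = v"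
    and dist_commute: "\<lbrakk>u \<in> V; v \<in> V\<rbrakk> \<Longrightarrow> d u v = d v u"
    and dist_triangle: "\<lbrakk>u \<in> V; v \<in> V; w \<in> V\<rbrakk> \<Longrightarrow> d u w \<le> d u v + d v w"
    and dist_step: "\<lbrakk>u \<in> V; v \<in> V; d u v = Suc m\<rbrakk> \<Longrightarrow> \<exists>w\<in>V. d u w = 1 \<and> d w v = m"
    and dist_parity: "\<lbrakk>u \<in> V; v \<in> V; w \<in> V; d u v = 1\<rbrakk> \<Longrightarrow> d u w \<noteq> d v w"
    and balanced: "\<lbrakk>u \<in> V; v \<in> V; d u v = 1\<rbrakk> \<Longrightarrow>
      card {w \<in> V. d u w = i \<and> d v w = Suc i} = card {w \<in> V. d u w = Suc i \<and> d v w = i}"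
begin

definition nbrs :: "'a \<Rightarrow> 'a set" where
  "nbrs u = {w \<in> V. d u w = 1}"

text \<open>For an edge these are the sets usually written \<open>W_uv\<close> in the theory of
  distance-balanced graphs.\<close>

definition closer :: "'a \<Rightarrow> 'a \<Rightarrow> 'a set" where
  "closer u v = {w \<in> V. d u w < d v w}"

definition separates :: "'a set \<Rightarrow> 'a set \<Rightarrow> 'a set \<Rightarrow> bool" where
  "separates S A B \<longleftrightarrow> A \<union> B \<union> S = V \<and> A \<inter> B = {} \<and> A \<inter> S = {} \<and> B \<inter> S = {} \<and>
     A \<noteq> {} \<and> B \<noteq> {} \<and> (\<forall>a\<in>A. \<forall>b\<in>B. d a b \<noteq> 1)"

lemma dist_self [simp]: "u \<in> V \<Longrightarrow> d u u = 0"
  by (simp add: dist_eq_0_iff)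

lemma finite_subset_V: "A \<subseteq> V \<Longrightarrow> finite A"
  using finite_V finite_subset by blast

section \<open>Balance across an edge, regularity and eccentricity\<close>

lemma dist_adjacent_cases:
  assumes "u \<in> V" "v \<in> V" "w \<in> V" "d u v = 1"
  shows "d u w = Suc (d v w) \<or> d v w = Suc (d u w)"
  using dist_triangle[of u v w] dist_triangle[of v u w] dist_parity[of u v w]
    dist_commute[of u v] assms by linarith

text \<open>Sum the balance condition over all levels: across an edge the smaller distance is below
  the larger by exactly one. \<open>I\<close> collects the distances that occur, so the sum is
  finite.\<close>

lemma card_closer:
  assumes "u \<in> V" "v \<in> V" "d u v = 1"
  shows "card (closer u v) = card (closer v u)"
proof -
  define I where "I = d u ` V \<union> d v ` V"
  let ?F = "\<lambda>i. {w \<in> V. d u w = i \<and> d v w = Suc i}"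
  let ?G = "\<lambda>i. {w \<in> V. d u w = Suc i \<and> d v w = i}"
  have "finite I"
    using finite_V by (simp add: I_def)
  have F: "closer u v = (\<Union>i\<in>I. ?F i)" and G: "closer v u = (\<Union>i\<in>I. ?G i)"
    using dist_adjacent_cases[OF assms(1,2) _ assms(3)]
    by (force simp: closer_def I_def)+
  have "card (closer u v) = (\<Sum>i\<in>I. card (?F i))"
    unfolding F using \<open>finite I\<close> finite_V by (intro card_UN_disjoint) auto
  also have "\<dots> = (\<Sum>i\<in>I. card (?G i))"
    using balanced[OF assms] by simp
  also have "\<dots> = card (closer v u)"
    unfolding G using \<open>finite I\<close> finite_V by (intro card_UN_disjoint[symmetric]) auto
  finally show ?thesis .
qed

text \<open>Connectedness is built into \<open>d\<close> being natural-valued: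
  \<open>dist_step\<close> moves \<open>u\<close> one edge closer to \<open>v\<close>, so induction
  on \<open>d u v\<close> gets there.\<close>

lemma adjacent_induct:
  assumes "u \<in> V" "v \<in> V" "P u"
    and step: "\<And>u v. \<lbrakk>u \<in> V; v \<in> V; d u v = 1; P u\<rbrakk> \<Longrightarrow> P v"
  shows "P v"
  using assms(1-3)
proof (induction "d u v" arbitrary: u)
  case 0
  then show ?case by (simp add: dist_eq_0_iff)
next
  case (Suc m)
  obtain w where "w \<in> V" "d u w = 1" "d w v = m"
    using dist_step[OF Suc.prems(1,2)] Suc.hyps(2) by metis
  then show ?case
    using Suc step[of u w] by blast
qed

text \<open>There are no triangles, so the neighbours of one end of an edge, other than the other
  end, are at distance 2 from that end. Balance at level 1 compares exactly these sets.\<close>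

lemma card_nbrs_eq:
  assumes "u \<in> V" "v \<in> V"
  shows "card (nbrs u) = card (nbrs v)"
proof -
  have adj: "card (nbrs u) = card (nbrs v)" if uv: "u \<in> V" "v \<in> V" "d u v = 1" for u v
  proof -
    have vu: "d v u = 1"
      using uv dist_commute by simp
    have 1: "nbrs u - {v} = {w \<in> V. d u w = 1 \<and> d v w = Suc 1}"
      using uv vu dist_adjacent_cases[OF uv(1,2) _ uv(3)] dist_eq_0_iff[of v]
      by (fastforce simp: nbrs_def)
    have 2: "nbrs v - {u} = {w \<in> V. d u w = Suc 1 \<and> d v w = 1}"
      using uv vu dist_adjacent_cases[OF uv(1,2) _ uv(3)] dist_eq_0_iff[of u]
      by (fastforce simp: nbrs_def)
    have "card (nbrs u - {v}) = card (nbrs v - {u})"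
      unfolding 1 2 by (rule balanced[OF uv])
    moreover have "v \<in> nbrs u" "u \<in> nbrs v" "finite (nbrs u)" "finite (nbrs v)"
      using uv vu finite_V by (auto simp: nbrs_def)
    ultimately show ?thesis
      by (metis card_Suc_Diff1)
  qed
  show ?thesis
    by (rule adjacent_induct[of u v "\<lambda>w. card (nbrs u) = card (nbrs w)"]) (use assms adj in auto)
qed

text \<open>Only a vertex with \<open>d u w = m\<close> and \<open>d v w = Suc m\<close> could break
  the bound at a neighbour \<open>v\<close> of \<open>u\<close>, and balance at level
  \<open>m\<close> matches such vertices with vertices at distance \<open>Suc m\<close> from
  \<open>u\<close>.\<close>

lemma dist_bound_transfer:
  assumes "u \<in> V" "v \<in> V" "\<forall>w\<in>V. d u w \<le> m"
  shows "\<forall>w\<in>V. d v w \<le> m"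
proof (rule adjacent_induct[OF assms(1,2), where P = "\<lambda>u. \<forall>w\<in>V. d u w \<le> m"])
  fix u v assume uv: "u \<in> V" "v \<in> V" "d u v = 1" and le: "\<forall>w\<in>V. d u w \<le> m"
  have none: "{w \<in> V. d u w = m \<and> d v w = Suc m} = {}"
  proof -
    have "{w \<in> V. d u w = Suc m \<and> d v w = m} = {}"
      using le by fastforce
    then have "card {w \<in> V. d u w = m \<and> d v w = Suc m} = 0"
      using balanced[OF uv, of m] by (metis card.empty)
    then show ?thesis
      using finite_V by simp
  qed
  show "\<forall>w\<in>V. d v w \<le> m"
  proof
    fix w assume w: "w \<in> V"
    show "d v w \<le> m"
      using dist_adjacent_cases[OF uv(1,2) w uv(3)] le w none by (cases "d u w = m") force+
  qed
qed (fact assms(3))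

text \<open>Bounds transfer in both directions, so a vertex with all distances below
  \<open>D\<close> would lower the maximum at \<open>v\<close> as well.\<close>

lemma common_eccentricity:
  obtains D where "\<And>u w. \<lbrakk>u \<in> V; w \<in> V\<rbrakk> \<Longrightarrow> d u w \<le> D" "\<And>u. u \<in> V \<Longrightarrow> \<exists>w\<in>V. d u w = D"
proof (cases "V = {}")
  case False
  then obtain v where v: "v \<in> V" by blast
  define D where "D = Max (d v ` V)"
  have le: "d u w \<le> D" if "u \<in> V" "w \<in> V" for u w
    using dist_bound_transfer[OF v that(1), of D] that finite_V by (simp add: D_def)
  have "\<exists>w\<in>V. d u w = D" if u: "u \<in> V" for u
  proof (rule ccontr)
    assume "\<not> ?thesis"
    then have lt: "\<forall>w\<in>V. d u w < D"
      using le[OF u] by (metis le_neq_implies_less)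
    then have "\<forall>w\<in>V. d v w \<le> D - 1"
      using dist_bound_transfer[OF u v, of "D - 1"] by fastforce
    moreover have "D \<in> d v ` V"
      using v finite_V by (auto simp: D_def intro: Max_in)
    ultimately show False
      using lt v by fastforce
  qed
  with le show ?thesis
    using that by blast
qed (use that in auto)

section \<open>Separators and geodesics\<close>

lemma separatesD:
  assumes "separates S A B"
  shows "A \<subseteq> V" "B \<subseteq> V" "S \<subseteq> V" "A \<union> B \<union> S = V" "A \<inter> B = {}" "A \<inter> S = {}" "B \<inter> S = {}"
    "A \<noteq> {}" "B \<noteq> {}" "\<And>a b. \<lbrakk>a \<in> A; b \<in> B\<rbrakk> \<Longrightarrow> d a b \<noteq> 1"
  using assms by (auto simp: separates_def)

lemma separates_sym:
  assumes "separates S A B" shows "separates S B A"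
proof -
  have "d b a \<noteq> 1" if "a \<in> A" "b \<in> B" for a b
    using separatesD[OF assms] that dist_commute by (metis subsetD)
  then show ?thesis
    using assms unfolding separates_def by blast
qed

text \<open>Follow a geodesic from \<open>a\<close>: with no edge between \<open>A\<close> and
  \<open>B\<close>, it can leave \<open>A\<close> only through \<open>S\<close>.\<close>

lemma separator_dist:
  assumes sep: "separates S A B" and "a \<in> A" "b \<in> B"
  shows "\<exists>s\<in>S. d a b = d a s + d s b"
  using assms(2)
proof (induction "d a b" arbitrary: a)
  case 0
  then show ?case
    using separatesD[OF sep] assms(3) dist_eq_0_iff by (metis disjoint_iff subsetD)
next
  case (Suc m)
  note S = separatesD[OF sep]
  have V: "a \<in> V" "b \<in> V"
    using S Suc.prems assms(3) by auto
  obtain w where w: "w \<in> V" "d a w = 1" "d w b = m"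
    using dist_step[OF V] Suc.hyps(2) by metis
  then have "w \<in> A \<or> w \<in> S"
    using S Suc.prems by blast
  then show ?case
  proof
    assume "w \<in> A"
    then obtain s where s: "s \<in> S" "d w b = d w s + d s b"
      using Suc.hyps(1) w by metis
    then have "s \<in> V" using S by blast
    then have "d a b = d a s + d s b"
      using s w Suc.hyps(2) dist_triangle[OF V(1) w(1), of s] dist_triangle[OF V(1) _ V(2), of s]
      by fastforce
    with s show ?thesis by blast
  next
    assume "w \<in> S"
    then show ?thesis using w Suc.hyps(2) by (intro bexI[of _ w]) simp
  qed
qed

text \<open>From a vertex of \<open>A\<close> nearest to some \<open>b\<close>, the next vertex of a
  geodesic to \<open>b\<close> is outside \<open>A\<close> by minimality and outside
  \<open>B\<close> by separation. For empty \<open>S\<close> this is already a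
  contradiction.\<close>

lemma separator_nbr:
  assumes sep: "separates S A B"
  shows "\<exists>a\<in>A. \<exists>s\<in>S. d s a = 1"
proof -
  note S = separatesD[OF sep]
  obtain b where b: "b \<in> B" using S by blast
  obtain a where a: "a \<in> A" "\<And>a'. a' \<in> A \<Longrightarrow> d a b \<le> d a' b"
    using S(8) ex_has_least_nat[of "\<lambda>a. a \<in> A" _ "\<lambda>a. d a b"] by (metis ex_in_conv)
  have V: "a \<in> V" "b \<in> V" "a \<noteq> b" using S(1,2,5) a(1) b by auto
  then obtain m where "d a b = Suc m"
    using dist_eq_0_iff not0_implies_Suc by metis
  then obtain w where w: "w \<in> V" "d a w = 1" "d w b = m"
    using dist_step[OF V(1,2)] by metis
  then have "w \<notin> A" using a(2)[of w] \<open>d a b = Suc m\<close> by auto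
  moreover have "w \<notin> B" using S(10) a w by blast
  ultimately show ?thesis
    using S a w dist_commute[OF V(1) w(1)] by (metis UnE)
qed

text \<open>Let \<open>A\<close> be the smaller side and \<open>a\<close> a neighbour of
  \<open>y\<close> in it. All of \<open>B\<close> and \<open>y\<close> itself are closer to
  \<open>y\<close>, so the side of \<open>y\<close> has more vertices than \<open>A\<close>, which
  contains the side of \<open>a\<close>.\<close>

lemma no_cut_vertex:
  assumes "separates {y} A B"
  shows False
proof -
  have less: False if sep: "separates {y} A B" and le: "card A \<le> card B" for A B
  proof -
    note S = separatesD[OF sep]
    obtain a where a: "a \<in> A" "d y a = 1"
      using separator_nbr[OF sep] by blast
    have V: "a \<in> V" "y \<in> V" using S a by auto
    have "d y w < d a w" if "w \<in> insert y B" for w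
      using separator_dist[OF sep a(1), of w] that a V dist_commute[OF V] by auto
    moreover from this have "w \<in> A" if "w \<in> V" "d a w < d y w" for w
      using S(4) that by (metis Un_iff Un_insert_right insert_iff less_asym sup_bot_right)
    ultimately have "insert y B \<subseteq> closer y a" "closer a y \<subseteq> A"
      using S(2) V by (auto simp: closer_def simp del: dist_self)
    then have "card (insert y B) \<le> card (closer y a)" "card (closer a y) \<le> card A"
      using finite_subset_V S(1) by (auto simp: closer_def intro!: card_mono)
    moreover have "card (insert y B) = Suc (card B)"
      using S finite_subset_V[of B] by simp
    ultimately show False
      using card_closer[OF V(2,1) a(2)] le by simp
  qed
  then show False
    using assms separates_sym[OF assms] by (meson nle_le)
qed

section \<open>Exclusion of two-vertex separators\<close>

lemma two_separator_nbr:
  assumes sep: "separates {x, y} A B" and "x \<noteq> y"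
  shows "\<exists>a\<in>A. d x a = 1"
proof (rule ccontr)
  assume none: "\<not> ?thesis"
  note S = separatesD[OF sep]
  have "d a x \<noteq> 1" if "a \<in> A" for a
    using none that S dist_commute[of a x] by auto
  \<comment> \<open>Without neighbours in \<open>A\<close>, \<open>x\<close> can be moved over to
    \<open>B\<close>, which makes \<open>y\<close> a cut vertex.\<close>
  then have "separates {y} A (insert x B)"
    using S \<open>x \<noteq> y\<close> unfolding separates_def by auto
  then show False by (rule no_cut_vertex)
qed

text \<open>When \<open>a\<close> recedes from \<open>y\<close>, a detour from \<open>a\<close> to
  \<open>B\<close> through \<open>y\<close> gains nothing over \<open>x\<close>. Hence
  \<open>x\<close>, \<open>y\<close> and \<open>B\<close> are all closer to \<open>x\<close>, and
  the side of \<open>a\<close> fits into \<open>A\<close>.\<close>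

lemma receding_nbr_card:
  assumes sep: "separates {x, y} A B" and "x \<noteq> y" and a: "a \<in> A" "d x a = 1"
    and far: "d a y = Suc (d x y)"
  shows "card B + 2 \<le> card A"
proof -
  note S = separatesD[OF sep]
  have V: "a \<in> V" "x \<in> V" "y \<in> V" using S a by auto
  have "d x w < d a w" if w: "w \<in> B" for w
    using separator_dist[OF sep a(1) w] dist_triangle[OF V(2,3), of w] far a
      dist_commute[OF V(1,2)] S w by auto
  then have near: "d x w < d a w" if "w \<in> {x, y} \<union> B" for w
    using that V far a dist_commute[OF V(1,2)] by auto
  then have "w \<in> A" if "w \<in> V" "d a w < d x w" for w
    using S(4) that by (metis Un_iff less_asym)
  with near have "{x, y} \<union> B \<subseteq> closer x a" "closer a x \<subseteq> A"
    using S(2) V by (auto simp: closer_def simp del: dist_self)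
  then have "card ({x, y} \<union> B) \<le> card (closer x a)" "card (closer a x) \<le> card A"
    using finite_subset_V S(1) by (auto simp: closer_def intro!: card_mono)
  moreover have "card ({x, y} \<union> B) = card B + 2"
    using S finite_subset_V[of B] \<open>x \<noteq> y\<close> by simp
  ultimately show ?thesis
    using card_closer[OF V(2,1) a(2)] by simp
qed

lemma approaching_nbr:
  assumes sep: "separates {x, y} A B" and "x \<noteq> y" "card A \<le> card B" and a: "a \<in> A" "d x a = 1"
  shows "d x y = Suc (d a y)"
proof -
  note S = separatesD[OF sep]
  have "a \<in> V" "x \<in> V" "y \<in> V" using S a by auto
  then show ?thesis
    using dist_adjacent_cases[of x a y] receding_nbr_card[OF sep \<open>x \<noteq> y\<close> a] a assms(3) by linarith
qed

text \<open>If a geodesic from \<open>x\<close> into \<open>B\<close> passes \<open>y\<close>, its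
  next vertex escapes. Otherwise \<open>x\<close>, \<open>B\<close> and the set \<open>T\<close> of
  further neighbours of \<open>x\<close> in \<open>A\<close> are closer to \<open>x\<close> than to
  \<open>a\<close>, and \<open>card_closer\<close> gives
  \<open>|B| + 1 + |T| <= |A| + 1 - |T|\<close>.\<close>

lemma escaping_nbr_or_unique_nbr:
  assumes sep: "separates {x, y} A B" and "x \<noteq> y" and le: "card A \<le> card B"
  shows "(\<exists>b\<in>B. d y b = 1 \<and> d x b = Suc (d x y)) \<or>
    card A = card B \<and> (\<exists>a. nbrs x \<inter> A \<subseteq> {a})"
proof -
  note S = separatesD[OF sep]
  have sep': "separates {y, x} A B" using sep by (simp add: insert_commute)
  obtain a where a: "a \<in> A" "d x a = 1"
    using two_separator_nbr[OF sep \<open>x \<noteq> y\<close>] by blast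
  have V: "a \<in> V" "x \<in> V" "y \<in> V" using S a by auto
  have ay: "d x y = Suc (d a y)"
    by (rule approaching_nbr[OF sep \<open>x \<noteq> y\<close> le a])
  show ?thesis
  proof (cases "\<exists>w\<in>B. d x w = d x y + d y w")
    case True
    then obtain w where w: "w \<in> B" "d x w = d x y + d y w" by blast
    then have "w \<in> V" "w \<noteq> y" using S by auto
    then obtain m where m: "d y w = Suc m"
      using V dist_eq_0_iff not0_implies_Suc by metis
    then obtain b where b: "b \<in> V" "d y b = 1" "d b w = m"
      using dist_step[OF V(3) \<open>w \<in> V\<close>] by metis
    have xb: "d x b = Suc (d x y)"
      using dist_triangle[OF V(2) b(1) \<open>w \<in> V\<close>] dist_triangle[OF V(2,3) b(1)] b w(2) m by linarith
    have "b \<notin> A"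
    proof
      assume "b \<in> A"
      then have "d y x = Suc (d b x)"
        using approaching_nbr[OF sep' _ le _ b(2)] \<open>x \<noteq> y\<close> by simp
      then show False
        using xb dist_commute[OF V(2,3)] dist_commute[OF V(2) b(1)] by simp
    qed
    moreover have "b \<noteq> x" "b \<noteq> y"
      using xb b V by auto
    ultimately have "b \<in> B"
      using b(1) S(4) by blast
    with b xb show ?thesis by blast
  next
    case False
    define T where "T = nbrs x \<inter> A - {a}"
    have nearB: "d x w < d a w" if w: "w \<in> B" for w
    proof -
      have wV: "w \<in> V" using S w by blast
      have "d a w = d a x + d x w \<or> d a w = d a y + d y w"
        using separator_dist[OF sep a(1) w] by auto
      \<comment> \<open>If the geodesic from \<open>a\<close> passes \<open>y\<close>, then
        \<open>d x w = Suc (d a w)\<close> would mean \<open>d x w = d x y + d y w\<close>.\<close>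
      moreover have "d x w \<noteq> d x y + d y w" using False w by blast
      ultimately show ?thesis
        using dist_adjacent_cases[OF V(2,1) wV a(2)] ay dist_commute[OF V(1,2)] a(2) by linarith
    qed
    have nearT: "d x w < d a w" if w: "w \<in> T" for w
    proof -
      have wV: "w \<in> V" "d x w = 1" "w \<noteq> a" using w by (auto simp: T_def nbrs_def)
      then have "d a w \<noteq> 0" using V dist_eq_0_iff by metis
      then show ?thesis
        using dist_adjacent_cases[OF V(2,1) wV(1) a(2)] wV(2) by linarith
    qed
    have near: "d x w < d a w" if "w \<in> insert x B \<union> T" for w
      using that nearB nearT V a dist_commute[OF V(1,2)] by auto
    have "w \<in> insert y A - T" if "w \<in> V" "d a w < d x w" for w
      using S(4) that near by (metis Diff_iff Un_iff insert_iff less_asym singletonD)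
    with near have sub: "insert x B \<union> T \<subseteq> closer x a" "closer a x \<subseteq> insert y A - T"
      using S(2) V by (auto simp: closer_def T_def nbrs_def simp del: dist_self)
    have fin: "finite A" "finite B" "finite T"
      using S finite_subset_V by (auto simp: T_def)
    have "card (insert x B \<union> T) = Suc (card B) + card T"
      using fin S by (subst card_Un_disjoint) (auto simp: T_def)
    moreover have "card (insert y A - T) = Suc (card A) - card T"
      using fin S by (subst card_Diff_subset) (auto simp: T_def)
    moreover have "card (insert x B \<union> T) \<le> card (closer x a)"
      using sub(1) finite_V by (intro card_mono) (auto simp: closer_def)
    moreover have "card (closer a x) \<le> card (insert y A - T)"
      using sub(2) fin by (intro card_mono) auto
    ultimately have "card A = card B" "card T = 0"
      using card_closer[OF V(2,1) a(2)] le by linarith+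
    then have "nbrs x \<inter> A \<subseteq> {a}"
      using fin by (auto simp: T_def)
    with \<open>card A = card B\<close> show ?thesis by blast
  qed
qed

text \<open>The other alternative comes with equal cardinalities, so it can be applied with the
  sides exchanged too: \<open>x\<close> then has at most one neighbour on each side.\<close>

lemma escaping_nbr:
  assumes sep: "separates {x, y} A B" and "x \<noteq> y" and le: "card A \<le> card B"
    and deg: "3 \<le> card (nbrs x)"
  shows "\<exists>b\<in>B. d y b = 1 \<and> d x b = Suc (d x y)"
proof (rule ccontr)
  assume none: "\<not> ?thesis"
  note S = separatesD[OF sep]
  have sep': "separates {y, x} A B" using sep by (simp add: insert_commute)
  have V: "x \<in> V" "y \<in> V" using S by auto
  obtain a where eq: "card A = card B" and a: "nbrs x \<inter> A \<subseteq> {a}"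
    using escaping_nbr_or_unique_nbr[OF sep \<open>x \<noteq> y\<close> le] none by blast
  have "\<not> (\<exists>b\<in>A. d y b = 1 \<and> d x b = Suc (d x y))"
  proof
    assume "\<exists>b\<in>A. d y b = 1 \<and> d x b = Suc (d x y)"
    then obtain b where b: "b \<in> A" "d y b = 1" "d x b = Suc (d x y)" by blast
    then have "d y x = Suc (d b x)" "b \<in> V"
      using approaching_nbr[OF sep' _ le b(1,2)] \<open>x \<noteq> y\<close> S by auto
    then show False
      using b(3) V dist_commute[of x y] dist_commute[of x b] by simp
  qed
  then obtain b where b: "nbrs x \<inter> B \<subseteq> {b}"
    using escaping_nbr_or_unique_nbr[OF separates_sym[OF sep] \<open>x \<noteq> y\<close>] eq by auto
  \<comment> \<open>An edge between \<open>x\<close> and \<open>y\<close> would leave distance 0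
    from the approaching neighbour \<open>c\<close> to \<open>y\<close>.\<close>
  have "y \<notin> nbrs x"
  proof
    assume "y \<in> nbrs x"
    moreover obtain c where c: "c \<in> A" "d x c = 1"
      using two_separator_nbr[OF sep \<open>x \<noteq> y\<close>] by blast
    ultimately have "d c y = 0"
      using approaching_nbr[OF sep \<open>x \<noteq> y\<close> le c] by (simp add: nbrs_def)
    then show False
      using c S V dist_eq_0_iff[of c y] by auto
  qed
  moreover have "x \<notin> nbrs x" using V by (simp add: nbrs_def)
  moreover have "nbrs x \<subseteq> V" by (auto simp: nbrs_def)
  ultimately have "nbrs x \<subseteq> {a, b}"
    using a b S(4) by blast
  then have "card (nbrs x) \<le> card {a, b}" by (intro card_mono) auto
  also have "\<dots> \<le> 2" by (simp add: card_insert_if)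
  finally show False using deg by simp
qed

text \<open>The level counts of \<open>A\<close> include \<open>x\<close>, so that level \<open>n - 2\<close> is handled alike for \<open>n = 2\<close>.\<close>
lemma no_two_separator_ordered:
  assumes sep: "separates {x, y} A B" and "x \<noteq> y" and le: "card A \<le> card B"
    and deg: "3 \<le> card (nbrs x)"
  shows False
proof -
  define n where "n = d x y"
  note S = separatesD[OF sep]
  have sep': "separates {y, x} A B" using sep by (simp add: insert_commute)
  have fin: "finite A" "finite B" using S finite_subset_V by auto
  have V: "x \<in> V" "y \<in> V" using S by auto
  have yx: "d y x = n" using V dist_commute n_def by simp
  obtain b0 where b0: "b0 \<in> B" "d y b0 = 1" "d x b0 = Suc n"
    using escaping_nbr[OF assms] unfolding n_def by blast
  obtain a where a: "a \<in> A" "d x a = 1"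
    using two_separator_nbr[OF sep \<open>x \<noteq> y\<close>] by blast
  obtain c where c: "c \<in> A" "d y c = 1"
    using two_separator_nbr[OF sep'] \<open>x \<noteq> y\<close> by blast
  have V': "a \<in> V" "b0 \<in> V" "c \<in> V" using S a b0 c by auto
  have ay: "n = Suc (d a y)"
    unfolding n_def by (rule approaching_nbr[OF sep \<open>x \<noteq> y\<close> le a])
  have cx: "n = Suc (d c x)"
    using approaching_nbr[OF sep' _ le c] \<open>x \<noteq> y\<close> yx by simp
  have xc: "n = Suc (d x c)" using cx dist_commute V V' by simp
  have ax: "d a x = 1" "d b0 y = 1" "d b0 x = Suc n" "d c y = 1"
    using a b0 c dist_commute V V' by auto
  \<comment> \<open>As \<open>c\<close> is not \<open>x\<close>, \<open>n\<close> is at least 2;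
    writing it as \<open>Suc (Suc p)\<close> avoids truncated subtraction below.\<close>
  have "d x c \<noteq> 0" using dist_eq_0_iff[of x c] V V' c S by auto
  then obtain p where n2: "n = Suc (Suc p)" using xc not0_implies_Suc by blast
  have dist_A_B: "d u v = d u x + d x v \<or> d u v = d u y + d y v" if "u \<in> A" "v \<in> B" for u v
    using separator_dist[OF sep that] by auto
  have dist_B_A: "d u v = d u x + d x v \<or> d u v = d u y + d y v" if "u \<in> B" "v \<in> A" for u v
    using separator_dist[OF separates_sym[OF sep] that] by auto
  obtain D where D: "\<And>u w. \<lbrakk>u \<in> V; w \<in> V\<rbrakk> \<Longrightarrow> d u w \<le> D" "\<And>u. u \<in> V \<Longrightarrow> \<exists>w\<in>V. d u w = D"
    using common_eccentricity by blast
  obtain z where z: "z \<in> V" "d y z = D" using D(2) V by blast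

  text \<open>Every vertex antipodal to \<open>y\<close> lies in \<open>B\<close>, behind \<open>x\<close>: all neighbours of \<open>y\<close>, in
    particular \<open>b0\<close> and \<open>c\<close>, are closer to it than \<open>y\<close>.\<close>
  have toward: "D = Suc (d v z)" if "v \<in> V" "d y v = 1" for v
    using dist_adjacent_cases[OF V(2) that(1) z(1) that(2)] z(2) D(1)[OF that(1) z(1)] by linarith
  \<comment> \<open>A geodesic from \<open>b0\<close> into \<open>A\<close> passes \<open>x\<close>
    or \<open>y\<close>, and either way is longer than \<open>d y z\<close>, against
    \<open>toward\<close>.\<close>
  have "z \<notin> A"
  proof
    assume "z \<in> A"
    then show False
      using dist_B_A[OF b0(1)] toward[OF V'(2) b0(2)] ax z dist_triangle[OF V(2,1) z(1)] yx
      by fastforce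
  qed
  moreover have "z \<noteq> x"
    using toward[OF V'(2) b0(2)] ax(3) yx z(2) by (metis n_not_Suc_n Suc_n_not_le_n le_SucI order_refl)
  moreover have "z \<noteq> y"
    using toward[OF V'(2) b0(2)] z(2) dist_self[OF V(2)] by (metis nat.distinct(1))
  ultimately have zB: "z \<in> B" using S(4) z(1) by blast
  \<comment> \<open>Since \<open>c\<close> is closer to \<open>z\<close> than \<open>y\<close> is,
    its geodesic to \<open>z\<close> passes \<open>x\<close> and has length
    \<open>n - 1 + d x z\<close>.\<close>
  have Dz: "D = n + d x z"
    using dist_A_B[OF c(1) zB] toward[OF V'(3) c(2)] ax cx z(2) by linarith

  \<comment> \<open>The distance from \<open>w\<close> to \<open>z\<close> is at most
    \<open>D\<close>, so the geodesic cannot pass \<open>y\<close>; through \<open>x\<close> it has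
    length \<open>d w x + d x z\<close>, to be compared with \<open>Dz\<close>.\<close>
  have dist_A_le: "d x w \<le> n" if w: "w \<in> A" for w
  proof -
    have wV: "w \<in> V" "w \<noteq> y" using w S by auto
    then have "d w y \<noteq> 0" using dist_eq_0_iff V by metis
    then show ?thesis
      using dist_A_B[OF w zB] D(1)[OF wV(1) z(1)] Dz z(2) dist_commute[OF V(1) wV(1)] by linarith
  qed

  \<comment> \<open>The first vertex \<open>b\<close> of a geodesic from \<open>x\<close> to
    \<open>z\<close> is farther from \<open>y\<close> than \<open>x\<close> is, which places it in
    \<open>B\<close>.\<close>
  obtain m where m: "d x z = Suc m"
    using \<open>z \<noteq> x\<close> V z dist_eq_0_iff not0_implies_Suc by metis
  then obtain b where b: "b \<in> V" "d x b = 1" "d b z = m"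
    using dist_step[OF V(1) z(1)] by metis
  have by_far: "n < d b y"
    using dist_triangle[OF V(2) b(1) z(1)] dist_commute[OF V(2) b(1)] b m z(2) Dz by linarith
  have bB: "b \<in> B"
  proof -
    have "b \<notin> A"
      using approaching_nbr[OF sep \<open>x \<noteq> y\<close> le _ b(2)] by_far n_def by force
    moreover have "b \<noteq> x" "b \<noteq> y" using by_far b(2) V by auto
    ultimately show ?thesis using S(4) b(1) by blast
  qed
  have bx: "d b x = 1" using b dist_commute V by simp

  \<comment> \<open>A geodesic from \<open>b\<close> to \<open>A\<close> passes \<open>x\<close> or
    \<open>y\<close>; through \<open>y\<close> it is longer than \<open>n + d y w\<close>, hence
    than \<open>d x w\<close>. The disjunct \<open>d x w = 0\<close> guards the truncated
    subtraction.\<close>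
  have far_from_b: "d b w = Suc (d x w)" if "w \<in> V - B" for w
  proof -
    have w: "w \<in> V" "w \<in> A \<or> w = x \<or> w = y" using that S(4) by auto
    have "d b w \<noteq> d x w - 1 \<or> d x w = 0"
      using w(2)
    proof (elim disjE)
      assume "w \<in> A"
      then show ?thesis
        using dist_B_A[OF bB, of w] by_far bx dist_triangle[OF V(1,2) w(1)] n_def by linarith
    qed (use by_far n_def V in auto)
    then show ?thesis
      using dist_adjacent_cases[OF V(1) b(1) w(1) b(2)] by linarith
  qed
  \<comment> \<open>Through \<open>y\<close> the distance from \<open>a\<close> is
    \<open>n - 1 + d y w\<close>, at least \<open>n\<close>, so \<open>w\<close> cannot be closer to
    \<open>a\<close> than to \<open>x\<close>.\<close>
  have far_from_a: "d a w = Suc (d x w)" if w: "w \<in> B" "d x w \<le> n" for w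
  proof -
    have wV: "w \<in> V" "w \<noteq> y" using w S by auto
    then have "d y w \<noteq> 0" using dist_eq_0_iff V by metis
    then show ?thesis
      using dist_A_B[OF a(1) w(1)] dist_adjacent_cases[OF V(1) V'(1) wV(1) a(2)] ax ay w(2)
      by linarith
  qed

  \<comment> \<open>Balance at the edge from \<open>x\<close> to \<open>b\<close>: the side of
    \<open>x\<close> contains \<open>A\<close> and \<open>x\<close>, while the side of
    \<open>b\<close> lies inside \<open>B\<close>.\<close>
  have A_le_B: "card {w \<in> insert x A. d x w = i} \<le> card {w \<in> B. d x w = Suc i}" for i
  proof -
    have "insert x A \<subseteq> V - B"
      using S(1,5,7) V(1) by blast
    then have "{w \<in> insert x A. d x w = i} \<subseteq> {w \<in> V. d x w = i \<and> d b w = Suc i}"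
      using far_from_b by blast
    then have "card {w \<in> insert x A. d x w = i} \<le> card {w \<in> V. d x w = i \<and> d b w = Suc i}"
      using finite_V by (intro card_mono) simp_all
    also have "\<dots> = card {w \<in> V. d x w = Suc i \<and> d b w = i}"
      by (rule balanced[OF V(1) b(1,2)])
    also have "\<dots> \<le> card {w \<in> B. d x w = Suc i}"
      using far_from_b fin by (intro card_mono) force+
    finally show ?thesis .
  qed
  \<comment> \<open>Balance at the edge from \<open>x\<close> to \<open>a\<close>, with level
    \<open>i\<close> of \<open>B\<close> on the side of \<open>x\<close>.\<close>
  have B_le: "card {w \<in> B. d x w = i} \<le> card {w \<in> V. d x w = Suc i \<and> d a w = i}" if "i \<le> n" for i
  proof -
    have "card {w \<in> B. d x w = i} \<le> card {w \<in> V. d x w = i \<and> d a w = Suc i}"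
      using S(2) that far_from_a finite_V by (intro card_mono) auto
    also have "\<dots> = card {w \<in> V. d x w = Suc i \<and> d a w = i}"
      by (rule balanced[OF V(1) V'(1) a(2)])
    finally show ?thesis .
  qed

  \<comment> \<open>Level \<open>Suc n\<close> is beyond \<open>A\<close>, so \<open>w\<close> is in
    \<open>B\<close>. Its geodesic from \<open>a\<close> reaches \<open>y\<close> after
    \<open>n - 1\<close> of its \<open>n\<close> steps. The neighbour \<open>c\<close> of
    \<open>y\<close> is left out, which makes the bound strict.\<close>
  have "{w \<in> V. d x w = Suc n \<and> d a w = n} \<subseteq> nbrs y - {c}"
  proof
    fix w assume "w \<in> {w \<in> V. d x w = Suc n \<and> d a w = n}"
    then have w: "w \<in> V" "d x w = Suc n" "d a w = n" by auto
    then have "w \<notin> A" "w \<noteq> x" "w \<noteq> y"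
      using dist_A_le[of w] V n_def by auto
    then have "w \<in> B" using S(4) w(1) by blast
    then have "d y w = 1"
      using dist_A_B[OF a(1), of w] w ax ay by linarith
    then show "w \<in> nbrs y - {c}"
      using w \<open>w \<notin> A\<close> c by (auto simp: nbrs_def)
  qed
  then have "card {w \<in> V. d x w = Suc n \<and> d a w = n} \<le> card (nbrs y - {c})"
    using finite_V by (intro card_mono) (auto simp: nbrs_def)
  also have "\<dots> < card (nbrs y)"
    using c V' finite_V by (intro card_Diff1_less) (auto simp: nbrs_def)
  finally have few: "card {w \<in> insert x A. d x w = Suc p} < card (nbrs y)"
    using A_le_B[of "Suc p"] B_le[OF order_refl] unfolding n2 by linarith

  \<comment> \<open>Neighbours of \<open>w\<close> are at level \<open>n - 1\<close> or
    \<open>n + 1\<close>. Nothing of \<open>A\<close> is at \<open>n + 1\<close> and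
    \<open>y\<close> is at \<open>n\<close>, so all of them are among the vertices counted in
    \<open>few\<close>.\<close>
  have none_at_n: "d x w \<noteq> n" if w: "w \<in> A" for w
  proof
    assume eq: "d x w = n"
    have wV: "w \<in> V" using w S by auto
    have "nbrs w \<subseteq> {w \<in> insert x A. d x w = Suc p}"
    proof
      fix v assume "v \<in> nbrs w"
      then have v: "v \<in> V" "d w v = 1" by (auto simp: nbrs_def)
      then have "d x v = Suc n \<or> Suc (d x v) = n"
        using dist_adjacent_cases[OF wV v(1) V(1) v(2)] dist_commute[OF V(1) wV]
          dist_commute[OF V(1) v(1)] eq by auto
      moreover have "v \<notin> B" using S(10)[OF w] v by blast
      ultimately show "v \<in> {w \<in> insert x A. d x w = Suc p}"
        using S(4) v dist_A_le[of v] n2 n_def V by fastforce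
    qed
    then have "card (nbrs w) \<le> card {w \<in> insert x A. d x w = Suc p}"
      using fin by (intro card_mono) auto
    then show False
      using few card_nbrs_eq[OF wV V(2)] by linarith
  qed

  \<comment> \<open>Now level \<open>n\<close> of \<open>A\<close> is empty, and
    \<open>far_from_a\<close> excludes \<open>B\<close>.\<close>
  have "{w \<in> V. d x w = Suc (Suc p) \<and> d a w = Suc p} \<subseteq> {y}"
  proof
    fix w assume "w \<in> {w \<in> V. d x w = Suc (Suc p) \<and> d a w = Suc p}"
    then have w: "w \<in> V" "d x w = n" "d a w \<noteq> Suc n" using n2 by auto
    then have "w \<notin> A" "w \<noteq> x" "w \<notin> B"
      using none_at_n[of w] far_from_a[of w] V n2 by auto
    then show "w \<in> {y}" using S(4) w(1) by blast
  qed
  then have "card {w \<in> V. d x w = Suc (Suc p) \<and> d a w = Suc p} \<le> card {y}"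
    by (intro card_mono) auto
  then have one: "card {w \<in> insert x A. d x w = p} \<le> 1"
    using A_le_B[of p] B_le[of "Suc p"] n2 by simp

  \<comment> \<open>\<open>c\<close> is at level \<open>n - 1\<close>; its neighbours at level
    \<open>n\<close> reduce to \<open>y\<close>, and by \<open>one\<close> at most one is at level
    \<open>p\<close>.\<close>
  have "nbrs c \<subseteq> insert y {w \<in> insert x A. d x w = p}"
  proof
    fix v assume "v \<in> nbrs c"
    then have v: "v \<in> V" "d c v = 1" by (auto simp: nbrs_def)
    then have "d x v = n \<or> d x v = p"
      using dist_adjacent_cases[OF V'(3) v(1) V(1) v(2)] dist_commute[OF V(1) V'(3)]
        dist_commute[OF V(1) v(1)] xc n2 by auto
    moreover have "v \<notin> B" using S(10)[OF c(1)] v by blast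
    ultimately show "v \<in> insert y {w \<in> insert x A. d x w = p}"
      using S(4) v none_at_n[of v] n2 V by fastforce
  qed
  then have "card (nbrs c) \<le> card (insert y {w \<in> insert x A. d x w = p})"
    using fin by (intro card_mono) auto
  also have "\<dots> \<le> Suc (card {w \<in> insert x A. d x w = p})"
    using fin by (simp add: card_insert_if)
  finally show False
    using one deg card_nbrs_eq[OF V'(3) V(1)] by linarith
qed

lemma no_two_separator:
  assumes sep: "separates {x, y} A B" and "x \<noteq> y" and deg: "3 \<le> card (nbrs x)"
  shows False
  using no_two_separator_ordered[OF sep assms(2) _ deg]
    no_two_separator_ordered[OF separates_sym[OF sep] assms(2) _ deg] by linarith

section \<open>Two-regular graphs as cycles\<close>

text \<open>A walk that never turns back first repeats at its starting vertex. The vertices visited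
  are closed under adjacency, so they exhaust \<open>V\<close>.\<close>

lemma two_regular_enumeration:
  assumes "V \<noteq> {}" and deg: "\<And>u. u \<in> V \<Longrightarrow> card (nbrs u) = 2"
  obtains f and n :: nat where "3 \<le> n" "bij_betw f {..<n} V"
    "\<forall>i<n. \<forall>j<n. d (f i) (f j) = 1 \<longleftrightarrow> j = (i + 1) mod n \<or> i = (j + 1) mod n"
proof -
  \<comment> \<open>The choice runs over pairs of consecutive vertices, so that each state remembers
    where the walk came from.\<close>
  have "\<exists>g. \<forall>i::nat. (fst (g i) \<in> V \<and> snd (g i) \<in> V \<and> d (fst (g i)) (snd (g i)) = 1) \<and>
      (fst (g (Suc i)) = snd (g i) \<and> snd (g (Suc i)) \<noteq> fst (g i))"
  proof (rule dependent_nat_choice)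
    obtain u where "u \<in> V" using assms(1) by blast
    moreover then have "nbrs u \<noteq> {}" using deg[of u] by auto
    ultimately show "\<exists>p. fst p \<in> V \<and> snd p \<in> V \<and> d (fst p) (snd p) = 1"
      by (auto simp: nbrs_def)
  next
    fix p :: "'a \<times> 'a" and i :: nat
    assume p: "fst p \<in> V \<and> snd p \<in> V \<and> d (fst p) (snd p) = 1"
    then have "\<not> nbrs (snd p) \<subseteq> {fst p}"
      using deg[of "snd p"] card_mono[of "{fst p}" "nbrs (snd p)"] by auto
    then obtain w where "w \<in> nbrs (snd p)" "w \<noteq> fst p" by blast
    then show "\<exists>q. (fst q \<in> V \<and> snd q \<in> V \<and> d (fst q) (snd q) = 1) \<and>
        (fst q = snd p \<and> snd q \<noteq> fst p)"
      using p by (intro exI[of _ "(snd p, w)"]) (auto simp: nbrs_def)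
  qed
  then obtain g where g: "\<And>i::nat. fst (g i) \<in> V" "\<And>i. d (fst (g i)) (snd (g i)) = 1"
      "\<And>i. fst (g (Suc i)) = snd (g i)" "\<And>i. snd (g (Suc i)) \<noteq> fst (g i)" by blast
  define f where "f = (\<lambda>i. fst (g i))"
  have fV: "f i \<in> V" and f_adj: "d (f i) (f (Suc i)) = 1" and f_new: "f (Suc (Suc i)) \<noteq> f i" for i
    using g(1)[of i] g(2)[of i] g(3)[of i] g(3)[of "Suc i"] g(4)[of i] by (auto simp: f_def)
  have nbrs_f_Suc: "nbrs (f (Suc i)) = {f i, f (Suc (Suc i))}" for i
  proof (rule card_seteq[symmetric])
    show "finite (nbrs (f (Suc i)))" using finite_V by (simp add: nbrs_def)
    show "{f i, f (Suc (Suc i))} \<subseteq> nbrs (f (Suc i))"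
      using fV f_adj dist_commute[of "f i" "f (Suc i)"] by (simp add: nbrs_def)
    show "card (nbrs (f (Suc i))) \<le> card {f i, f (Suc (Suc i))}"
      using deg[OF fV] f_new[of i] by simp
  qed
  have f_neq: "f i \<noteq> f (Suc i)" for i
    using f_adj[of i] dist_self[OF fV[of i]] by auto
  have "\<exists>n. f n \<in> f ` {..<n}"
  proof (rule ccontr)
    assume none: "\<not> ?thesis"
    have "inj f"
    proof (rule linorder_injI)
      fix i j :: nat assume "i < j"
      then show "f i \<noteq> f j" using none by (metis imageI lessThan_iff)
    qed
    then have "infinite (range f)" by (simp add: finite_image_iff)
    then show False using fV finite_V finite_subset by (metis image_subsetI)
  qed
  define n where "n = (LEAST n. f n \<in> f ` {..<n})"
  have n: "f n \<in> f ` {..<n}"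
    unfolding n_def by (rule LeastI_ex) fact
  have inj: "inj_on f {..<n}"
  proof (rule linorder_inj_onI')
    fix i j assume "i \<in> {..<n}" "j \<in> {..<n}" "i < j"
    then have "f j \<notin> f ` {..<j}"
      unfolding n_def by (intro not_less_Least) simp
    then show "f i \<noteq> f j"
      using \<open>i < j\<close> by (metis imageI lessThan_iff)
  qed
  then have f_eq: "f i = f j \<longleftrightarrow> i = j" if "i < n" "j < n" for i j
    using that by (auto dest: inj_onD)
  obtain j where j: "j < n" "f n = f j" using n by auto
  obtain n' where n': "n = Suc n'" using j by (cases n) auto
  \<comment> \<open>For positive \<open>j\<close>, \<open>f n'\<close> would be one of the two
    neighbours of \<open>f j\<close>: the earlier one contradicts injectivity, the later one forces
    a loop or a turn back.\<close>
  have "j = 0"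
  proof (rule ccontr)
    assume "j \<noteq> 0"
    then obtain i where i: "j = Suc i" by (cases j) auto
    have "d (f j) (f n') = 1"
      using f_adj[of n'] j(2) n' dist_commute[OF fV fV] by simp
    then have "f n' \<in> {f i, f (Suc (Suc i))}"
      using nbrs_f_Suc[of i] fV i by (auto simp: nbrs_def)
    moreover have "f n' \<noteq> f i"
      using f_eq[of n' i] i j(1) n' by simp
    ultimately have eq: "f n' = f (Suc j)" using i by simp
    show False
    proof (cases "Suc j < n")
      case True
      then have "n = Suc (Suc j)" using f_eq[of n' "Suc j"] eq n' by simp
      then show False using f_new[of j] j(2) by simp
    next
      case False
      then have "n = Suc j" using j(1) by simp
      then show False using f_neq[of j] j(2) by simp
    qed
  qed
  then have fn: "f n = f 0" using j by simp
  have n3: "3 \<le> n"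
  proof -
    have "n \<noteq> 1" using fn f_neq[of 0] by auto
    moreover have "n \<noteq> 2" using fn f_new[of 0] by (auto simp: numeral_2_eq_2)
    ultimately show ?thesis using j by simp
  qed
  \<comment> \<open>The starting vertex has no predecessor in the walk; closing up supplies
    \<open>f n'\<close>.\<close>
  have nbrs_f_0: "nbrs (f 0) = {f 1, f n'}"
  proof (rule card_seteq[symmetric])
    show "finite (nbrs (f 0))" using finite_V by (simp add: nbrs_def)
    show "{f 1, f n'} \<subseteq> nbrs (f 0)"
      using fV f_adj[of 0] f_adj[of n'] fn n' dist_commute[OF fV[of n'] fV[of 0]]
      by (simp add: nbrs_def)
    show "card (nbrs (f 0)) \<le> card {f 1, f n'}"
      using deg[OF fV] f_eq[of 1 n'] n3 n' by simp
  qed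
  have adj: "d (f i) (f j) = 1 \<longleftrightarrow> j = (i + 1) mod n \<or> i = (j + 1) mod n" if ij: "i < n" "j < n" for i j
  proof (cases i)
    case 0
    have "d (f i) (f j) = 1 \<longleftrightarrow> f j \<in> {f 1, f n'}"
      using nbrs_f_0 fV 0 by (auto simp: nbrs_def)
    also have "\<dots> \<longleftrightarrow> j = 1 \<or> j = n'"
      using f_eq ij n3 n' by simp
    finally show ?thesis
      using 0 ij n3 n' by (auto simp: mod_Suc)
  next
    case (Suc k)
    have "d (f i) (f j) = 1 \<longleftrightarrow> f j \<in> {f k, f (Suc i)}"
      using nbrs_f_Suc[of k] fV Suc by (auto simp: nbrs_def)
    also have "f (Suc i) = f (Suc i mod n)"
      using ij fn by (auto simp: mod_Suc)
    also have "f j \<in> {f k, f (Suc i mod n)} \<longleftrightarrow> j = k \<or> j = Suc i mod n"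
      using f_eq ij Suc n3 by simp
    finally show ?thesis
      using Suc ij n3 by (auto simp: mod_Suc)
  qed
  have "V \<subseteq> f ` {..<n}"
  proof
    fix v assume "v \<in> V"
    show "v \<in> f ` {..<n}"
    proof (rule adjacent_induct[of "f 0" v])
      show "f 0 \<in> f ` {..<n}" using n3 by auto
    next
      fix u w assume uw: "u \<in> V" "w \<in> V" "d u w = 1" "u \<in> f ` {..<n}"
      then obtain i where i: "i < n" "u = f i" by auto
      have w: "w \<in> nbrs (f i)" using uw i by (simp add: nbrs_def)
      show "w \<in> f ` {..<n}"
      proof (cases i)
        case 0
        then show ?thesis using w nbrs_f_0 n3 n' by auto
      next
        case (Suc k)
        then have "w = f k \<or> w = f (Suc i)" using w nbrs_f_Suc[of k] by auto
        moreover have "f (Suc i) = f (Suc i mod n)"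
          using i fn by (auto simp: mod_Suc)
        ultimately show ?thesis using i Suc n3 by auto
      qed
    qed (use fV \<open>v \<in> V\<close> in auto)
  qed
  then have "bij_betw f {..<n} V"
    using inj fV by (auto simp: bij_betw_def)
  then show ?thesis
    using that n3 adj by blast
qed

end

section \<open>The distance of a connected graph\<close>

text \<open>A natural-valued counterpart of \<open>graph_dist\<close>; without a walk from
  \<open>u\<close> to \<open>v\<close> the value of \<open>LEAST\<close> is unspecified.\<close>

definition (in pre_digraph) walk_dist :: "'a \<Rightarrow> 'a \<Rightarrow> nat" where
  "walk_dist u v = (LEAST n. \<exists>p. awalk u p v \<and> length p = n)"

context wf_digraph
begin

lemma walk_dist_le: "awalk u p v \<Longrightarrow> walk_dist u v \<le> length p"
  unfolding walk_dist_def by (rule Least_le) blast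

lemma shortest_awalk:
  assumes "u \<rightarrow>\<^sup>* v"
  obtains p where "awalk u p v" "length p = walk_dist u v"
proof -
  have "\<exists>n p. awalk u p v \<and> length p = n"
    using assms by (auto simp: reachable_awalk)
  then have "\<exists>p. awalk u p v \<and> length p = walk_dist u v"
    unfolding walk_dist_def by (rule LeastI_ex)
  then show ?thesis using that by blast
qed

lemma graph_dist_eq_walk_dist:
  assumes "u \<rightarrow>\<^sup>* v"
  shows "graph_dist G u v = ereal (real (walk_dist u v))"
proof -
  have cost: "awalk_cost (\<lambda>_. 1) p = real (length p)" for p
    by (induction p) auto
  obtain p where p: "awalk u p v" "length p = walk_dist u v"
    using shortest_awalk[OF assms] .
  show ?thesis
    unfolding graph_dist_def \<mu>_def cost
  proof (rule INF_eqI)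
    fix l assume "\<And>q. q \<in> {q. awalk u q v} \<Longrightarrow> l \<le> ereal (real (length q))"
    then show "l \<le> ereal (real (walk_dist u v))" using p by (metis mem_Collect_eq)
  qed (simp add: walk_dist_le)
qed

end

lemma (in sym_digraph) awalk_reverse:
  assumes "awalk u p v"
  shows "\<exists>q. awalk v q u \<and> length q = length p"
  using assms
proof (induction p arbitrary: u)
  case Nil
  then show ?case by (auto simp: awalk_Nil_iff)
next
  case (Cons e p)
  then have e: "e \<in> arcs G" "u = tail G e" "awalk (head G e) p v"
    by (auto simp: awalk_Cons_iff)
  obtain q where q: "awalk v q (head G e)" "length q = length p"
    using Cons.IH[OF e(3)] by blast
  have "head G e \<rightarrow> tail G e"
    using e(1) graph_symmetric by (auto simp: arcs_ends_conv)
  then obtain e' where "e' \<in> arcs G" "tail G e' = head G e" "head G e' = tail G e"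
    by (rule reachableE)
  then have "awalk v (q @ [e']) u"
    using q(1) e(2) by (metis arc_implies_awalk awalk_appendI)
  then show ?case using q(2) by (intro exI[of _ "q @ [e']"]) simp
qed

text \<open>\<open>connected\<close> refers to the symmetric closure, which adds nothing to
  reachability in a symmetric digraph.\<close>

lemma connected_reachable:
  assumes "sym_digraph G" "Digraph_Component.connected G" "u \<in> verts G" "v \<in> verts G"
  shows "u \<rightarrow>\<^sup>*\<^bsub>G\<^esub> v"
proof -
  interpret sym_digraph G by fact
  have "u \<rightarrow>\<^sup>*\<^bsub>with_proj (mk_symmetric G)\<^esub> v"
    using assms by (auto simp: connected_def strongly_connected_def)
  then show ?thesis by (simp add: reachable_mk_symmetric_eq[OF sym_arcs])
qed

lemma (in graph) walk_dist_eq_1_iff: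
  assumes "Digraph_Component.connected G" "u \<in> verts G" "v \<in> verts G"
  shows "walk_dist u v = 1 \<longleftrightarrow> u \<rightarrow> v"
proof
  assume 1: "walk_dist u v = 1"
  obtain p where "awalk u p v" "length p = 1"
    using shortest_awalk[OF connected_reachable[OF _ assms]] sym_digraph_axioms 1 by metis
  then obtain e where "p = [e]" "awalk u [e] v"
    by (cases p) auto
  then show "u \<rightarrow> v" by (auto simp: awalk_simps arcs_ends_conv)
next
  assume "u \<rightarrow> v"
  then obtain e where e: "e \<in> arcs G" "tail G e = u" "head G e = v" by (rule reachableE)
  then have "walk_dist u v \<le> 1"
    using walk_dist_le[OF arc_implies_awalk[OF e(1)]] by simp
  moreover have "walk_dist u v \<noteq> 0"
  proof
    assume "walk_dist u v = 0"
    then obtain p where "awalk u p v" "length p = 0"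
      using shortest_awalk[OF connected_reachable[OF _ assms]] sym_digraph_axioms by metis
    then show False using no_loops[OF e(1)] e by (auto simp: awalk_Nil_iff)
  qed
  ultimately show "walk_dist u v = 1" by simp
qed

lemma (in graph) balanced_bipartite_metric_walk_dist:
  assumes conn: "Digraph_Component.connected G" and bip: "bipartite G"
    and sdb: "strongly_distance_balanced G"
  shows "balanced_bipartite_metric (verts G) walk_dist"
proof
  have walk: "\<exists>p. awalk u p v \<and> length p = walk_dist u v" if "u \<in> verts G" "v \<in> verts G" for u v
    using shortest_awalk[OF connected_reachable[OF sym_digraph_axioms conn that]] by metis
  show "finite (verts G)" by simp
  show "walk_dist u v = 0 \<longleftrightarrow> u = v" if uv: "u \<in> verts G" "v \<in> verts G" for u v
  proof
    assume "walk_dist u v = 0"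
    then show "u = v" using walk[OF uv] by (auto simp: awalk_Nil_iff)
  next
    assume "u = v"
    then show "walk_dist u v = 0"
      using uv walk_dist_le[of u "[]" v] by (simp add: awalk_Nil_iff)
  qed
  have le: "walk_dist v u \<le> walk_dist u v" if uv: "u \<in> verts G" "v \<in> verts G" for u v
    using walk[OF uv] awalk_reverse walk_dist_le by metis
  then show "walk_dist u v = walk_dist v u" if "u \<in> verts G" "v \<in> verts G" for u v
    using that by (simp add: le antisym)
  show "walk_dist u w \<le> walk_dist u v + walk_dist v w"
    if uvw: "u \<in> verts G" "v \<in> verts G" "w \<in> verts G" for u v w
  proof -
    obtain p q where "awalk u p v" "length p = walk_dist u v" "awalk v q w" "length q = walk_dist v w"
      using walk uvw by metis
    then show ?thesis using walk_dist_le[of u "p @ q" w] awalk_appendI by simp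
  qed
  note triangle = this
  show "\<exists>w\<in>verts G. walk_dist u w = 1 \<and> walk_dist w v = m"
    if uv: "u \<in> verts G" "v \<in> verts G" and m: "walk_dist u v = Suc m" for u v m
  proof -
    obtain p where p: "awalk u p v" "length p = Suc m" using walk[OF uv] m by auto
    then obtain e q where eq: "p = e # q" by (cases p) auto
    let ?w = "head G e"
    have e: "e \<in> arcs G" "u = tail G e" "awalk ?w q v" using p eq by (auto simp: awalk_Cons_iff)
    have w: "?w \<in> verts G" using e by simp
    have 1: "walk_dist u ?w = 1"
      using walk_dist_eq_1_iff[OF conn uv(1) w] e by (auto simp: arcs_ends_conv)
    moreover have "walk_dist ?w v = m"
      using triangle[OF uv(1) w uv(2)] 1 m walk_dist_le[OF e(3)] p(2) eq by simp
    ultimately show ?thesis using w by blast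
  qed
  obtain A B where AB: "A \<union> B = verts G" "A \<inter> B = {}"
    "\<And>u v. u \<rightarrow> v \<Longrightarrow> u \<in> A \<and> v \<in> B \<or> u \<in> B \<and> v \<in> A"
    using bip unfolding bipartite_def by blast
  \<comment> \<open>Every arc changes sides, so the parity of a walk tells whether its ends are on
    the same side; applied to shortest walks this gives \<open>dist_parity\<close>.\<close>
  have side: "(u \<in> A \<longleftrightarrow> v \<in> A) \<longleftrightarrow> even (length p)" if "awalk u p v" for u p v
    using that
  proof (induction p arbitrary: u)
    case (Cons e p)
    then have e: "e \<in> arcs G" "u = tail G e" "awalk (head G e) p v"
      by (auto simp: awalk_Cons_iff)
    then have "u \<rightarrow> head G e" by (auto simp: arcs_ends_conv)
    then show ?case using AB(2) AB(3)[of u "head G e"] Cons.IH[OF e(3)] by auto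
  qed (simp add: awalk_Nil_iff)
  show "walk_dist u w \<noteq> walk_dist v w"
    if uvw: "u \<in> verts G" "v \<in> verts G" "w \<in> verts G" "walk_dist u v = 1" for u v w
  proof -
    have parity: "(u \<in> A \<longleftrightarrow> v \<in> A) \<longleftrightarrow> even (walk_dist u v)" if "u \<in> verts G" "v \<in> verts G" for u v
      using walk[OF that] side by metis
    show ?thesis
      using parity[OF uvw(1,3)] parity[OF uvw(2,3)] parity[OF uvw(1,2)] uvw(4) by auto
  qed
  show "card {w \<in> verts G. walk_dist u w = i \<and> walk_dist v w = Suc i} =
      card {w \<in> verts G. walk_dist u w = Suc i \<and> walk_dist v w = i}"
    if uv: "u \<in> verts G" "v \<in> verts G" "walk_dist u v = 1" for u v i
  proof -
    have sphere: "dist_sphere G i u = {w \<in> verts G. walk_dist u w = i}" if "u \<in> verts G" for u i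
      using graph_dist_eq_walk_dist[OF connected_reachable[OF sym_digraph_axioms conn that]]
      by (auto simp: dist_sphere_def)
    have "u \<rightarrow> v" using uv walk_dist_eq_1_iff[OF conn] by blast
    then have "card (dist_sphere G i u \<inter> dist_sphere G (i + 1) v) =
        card (dist_sphere G (i + 1) u \<inter> dist_sphere G i v)"
      using sdb by (simp add: strongly_distance_balanced_def)
    moreover have "dist_sphere G i u \<inter> dist_sphere G (i + 1) v =
        {w \<in> verts G. walk_dist u w = i \<and> walk_dist v w = Suc i}"
      "dist_sphere G (i + 1) u \<inter> dist_sphere G i v =
        {w \<in> verts G. walk_dist u w = Suc i \<and> walk_dist v w = i}"
      using sphere uv by auto
    ultimately show ?thesis by simp
  qed
qed

section \<open>Isomorphism with a cycle, and splitting of disconnected subgraphs\<close>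

lemma (in nomulti_digraph) is_cycle_graphI:
  fixes n :: nat
  assumes "3 \<le> n" and bij: "bij_betw f {..<n} (verts G)"
    and adj: "\<And>i j. \<lbrakk>i < n; j < n\<rbrakk> \<Longrightarrow> f i \<rightarrow> f j \<longleftrightarrow> j = (i + 1) mod n \<or> i = (j + 1) mod n"
  shows "is_cycle_graph G"
proof -
  let ?C = "with_proj (cycle_graph n)"
  \<comment> \<open>Arcs are objects of their own, so the isomorphism also needs a map on arcs;
    \<open>no_multi_arcs\<close> makes the chosen arc the only one.\<close>
  define arc where "arc = (\<lambda>(i, j). SOME e. e \<in> arcs G \<and> tail G e = f i \<and> head G e = f j)"
  have arc: "arc e \<in> arcs G \<and> tail G (arc e) = f (fst e) \<and> head G (arc e) = f (snd e)"
    if "e \<in> parcs (cycle_graph n)" for e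
  proof -
    have "f (fst e) \<rightarrow> f (snd e)"
      using that adj by (auto simp: cycle_graph_def)
    then have "\<exists>e'. e' \<in> arcs G \<and> tail G e' = f (fst e) \<and> head G e' = f (snd e)"
      by (auto simp: arcs_ends_conv)
    from someI_ex[OF this] show ?thesis by (simp add: arc_def case_prod_unfold)
  qed
  have f_eq: "f i = f j \<longleftrightarrow> i = j" if "i < n" "j < n" for i j
    using bij that by (auto simp: bij_betw_def dest: inj_onD)
  have ends: "fst e < n" "snd e < n" if "e \<in> parcs (cycle_graph n)" for e
    using that by (auto simp: cycle_graph_def)
  have "wf_digraph ?C"
    by unfold_locales (auto simp: cycle_graph_def)
  moreover have "inj_on f {..<n}" "f ` {..<n} = verts G"
    using bij by (auto simp: bij_betw_def)
  moreover have "inj_on arc (parcs (cycle_graph n))"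
  proof (rule inj_onI)
    fix e e' assume e: "e \<in> parcs (cycle_graph n)" "e' \<in> parcs (cycle_graph n)" "arc e = arc e'"
    then have "f (fst e) = f (fst e')" "f (snd e) = f (snd e')"
      using arc by metis+
    then show "e = e'" using f_eq ends e by (simp add: prod_eq_iff)
  qed
  moreover have "arc ` parcs (cycle_graph n) = arcs G"
  proof
    show "arc ` parcs (cycle_graph n) \<subseteq> arcs G" using arc by auto
    show "arcs G \<subseteq> arc ` parcs (cycle_graph n)"
    proof
      fix e assume e: "e \<in> arcs G"
      then have "tail G e \<in> f ` {..<n}" "head G e \<in> f ` {..<n}"
        using bij by (auto simp: bij_betw_def)
      then obtain i j where ij: "i < n" "j < n" "tail G e = f i" "head G e = f j" by auto
      moreover have "f i \<rightarrow> f j" using e ij by (force simp: arcs_ends_conv)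
      ultimately have mem: "(i, j) \<in> parcs (cycle_graph n)"
        using adj by (auto simp: cycle_graph_def)
      then have "e = arc (i, j)"
        using arc[OF mem] e ij by (intro no_multi_arcs) (auto simp: arc_to_ends_def)
      with mem show "e \<in> arc ` parcs (cycle_graph n)" by blast
    qed
  qed
  ultimately have "digraph_iso ?C G"
    unfolding digraph_iso_def pre_digraph.digraph_isomorphism_def app_iso_def
    using arc
    by (intro exI[of _ "\<lparr>iso_verts = f, iso_arcs = arc, iso_head = head G, iso_tail = tail G\<rparr>"])
      (auto simp: cycle_graph_def)
  with assms(1) show ?thesis by (auto simp: is_cycle_graph_def)
qed

text \<open>Take for \<open>A\<close> what is reachable from \<open>u\<close> in the symmetric
  closure. Since \<open>connected\<close> includes nonemptiness, \<open>W\<close> has to be nonempty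
  for an unreachable pair to exist.\<close>

lemma (in wf_digraph) disconnected_induce_subgraph:
  assumes "W \<subseteq> verts G" "W \<noteq> {}" "\<not> Digraph_Component.connected (G \<restriction> W)"
  obtains A B where "A \<union> B = W" "A \<inter> B = {}" "A \<noteq> {}" "B \<noteq> {}"
    "\<And>a b. \<lbrakk>a \<in> A; b \<in> B\<rbrakk> \<Longrightarrow> \<not> a \<rightarrow> b"
proof -
  let ?H = "with_proj (mk_symmetric (G \<restriction> W))"
  interpret H: wf_digraph "G \<restriction> W" by (rule wellformed_induce_subgraph)
  interpret M: pair_wf_digraph "mk_symmetric (G \<restriction> W)" by (rule H.wellformed_mk_symmetric)
  obtain u v where uv: "u \<in> W" "v \<in> W" "\<not> u \<rightarrow>\<^sup>*\<^bsub>?H\<^esub> v"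
    using assms by (auto simp: connected_def strongly_connected_def)
  define A where "A = {w \<in> W. u \<rightarrow>\<^sup>*\<^bsub>?H\<^esub> w}"
  show ?thesis
  proof (rule that[of A "W - A"])
    show "A \<noteq> {}" using uv by (auto simp: A_def)
    show "W - A \<noteq> {}" using uv by (auto simp: A_def)
    show "\<not> a \<rightarrow> b" if a: "a \<in> A" and b: "b \<in> W - A" for a b
    proof
      assume "a \<rightarrow> b"
      then obtain e where e: "e \<in> arcs G" "tail G e = a" "head G e = b" by (rule reachableE)
      then have "e \<in> arcs (G \<restriction> W)" using a b by (auto simp: A_def)
      then have "(a, b) \<in> parcs (mk_symmetric (G \<restriction> W))"
        using e by (force simp: parcs_mk_symmetric)
      then have "u \<rightarrow>\<^sup>*\<^bsub>?H\<^esub> b"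
        using a M.reachable_adj_trans[of u a b] by (simp add: A_def)
      then show False using b by (simp add: A_def)
    qed
  qed (auto simp: A_def)
qed

theorem theorem5p1:
  fixes \<Gamma> :: "('a, 'b) pre_digraph"
  assumes "graph \<Gamma>"
    and "Digraph_Component.connected \<Gamma>"
    and "card (verts \<Gamma>) \<ge> 3"
    and "bipartite \<Gamma>"
    and "strongly_distance_balanced \<Gamma>"
    and "\<not> is_cycle_graph \<Gamma>"
  shows "three_connected \<Gamma>"
proof -
  interpret G: graph \<Gamma> by fact
  interpret M: balanced_bipartite_metric "verts \<Gamma>" G.walk_dist
    by (rule G.balanced_bipartite_metric_walk_dist[OF assms(2,4,5)])
  note adj = G.walk_dist_eq_1_iff[OF assms(2)]
  have fin: "finite (M.nbrs u)" for u by (simp add: M.nbrs_def)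
  have "verts \<Gamma> \<noteq> {}" using assms(3) by auto
  \<comment> \<open>By regularity every degree would be at most 1, so nothing beyond
    \<open>u\<close> and one neighbour could be reached, against three vertices.\<close>
  have not1: "\<not> card (M.nbrs u) \<le> 1" if u: "u \<in> verts \<Gamma>" for u
  proof
    assume le: "card (M.nbrs u) \<le> 1"
    then obtain v where v: "M.nbrs u \<subseteq> {v}"
      using fin[of u] by (metis card_le_Suc0_iff_eq One_nat_def insert_iff subsetI)
    have "w \<in> {u, v}" if w: "w \<in> verts \<Gamma>" for w
    proof (rule M.adjacent_induct[OF u w, of "\<lambda>w. w \<in> {u, v}"])
      fix s t assume st: "s \<in> verts \<Gamma>" "t \<in> verts \<Gamma>" "G.walk_dist s t = 1" "s \<in> {u, v}"
      show "t \<in> {u, v}"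
      proof (cases "s = u")
        case True
        then show ?thesis using st v by (auto simp: M.nbrs_def)
      next
        case False
        then have s: "s = v" using st by simp
        have "card (M.nbrs s) \<le> 1" using M.card_nbrs_eq[OF st(1) u] le by simp
        moreover have "u \<in> M.nbrs s"
        proof -
          have "M.nbrs u \<noteq> {}"
          proof
            assume "M.nbrs u = {}"
            then have "card (M.nbrs s) = 0" using M.card_nbrs_eq[OF st(1) u] by simp
            then show False using fin[of s] st by (auto simp: M.nbrs_def)
          qed
          then have "v \<in> M.nbrs u" using v by blast
          then show ?thesis using s u M.dist_commute[of u v] by (simp add: M.nbrs_def)
        qed
        moreover have "t \<in> M.nbrs s" using st by (simp add: M.nbrs_def)
        ultimately have "t = u"
          using fin[of s] by (metis card_le_Suc0_iff_eq One_nat_def)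
        then show ?thesis by simp
      qed
    qed simp
    then have "verts \<Gamma> \<subseteq> {u, v}" by blast
    then have "card (verts \<Gamma>) \<le> card {u, v}" by (intro card_mono) auto
    also have "\<dots> \<le> 2" by (simp add: card_insert_if)
    finally show False using assms(3) by simp
  qed
  have deg: "3 \<le> card (M.nbrs u)" if u: "u \<in> verts \<Gamma>" for u
  proof (rule ccontr)
    assume "\<not> ?thesis"
    then have "card (M.nbrs u) = 2" using not1[OF u] by simp
    then have deg2: "card (M.nbrs v) = 2" if "v \<in> verts \<Gamma>" for v
      using M.card_nbrs_eq[OF that u] by simp
    obtain f and n :: nat where f: "3 \<le> n" "bij_betw f {..<n} (verts \<Gamma>)"
      "\<forall>i<n. \<forall>j<n. G.walk_dist (f i) (f j) = 1 \<longleftrightarrow> j = (i + 1) mod n \<or> i = (j + 1) mod n"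
      by (rule M.two_regular_enumeration[OF \<open>verts \<Gamma> \<noteq> {}\<close> deg2])
    have fV: "f i \<in> verts \<Gamma>" if "i < n" for i
      using f(2) that by (auto simp: bij_betw_def)
    have "is_cycle_graph \<Gamma>"
      by (rule G.is_cycle_graphI[OF f(1,2)]) (use adj fV f(3) in simp)
    with assms(6) show False by contradiction
  qed
  obtain u where u: "u \<in> verts \<Gamma>" using \<open>verts \<Gamma> \<noteq> {}\<close> by blast
  have card4: "4 \<le> card (verts \<Gamma>)"
  proof -
    have "u \<notin> M.nbrs u" using u by (simp add: M.nbrs_def)
    then have "Suc 3 \<le> card (insert u (M.nbrs u))" using fin deg[OF u] by simp
    also have "\<dots> \<le> card (verts \<Gamma>)"
      using u by (intro card_mono) (auto simp: M.nbrs_def)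
    finally show ?thesis by simp
  qed
  moreover have "Digraph_Component.connected (\<Gamma> \<restriction> (verts \<Gamma> - S))"
    if S: "S \<subseteq> verts \<Gamma>" "card S \<le> 2" for S
  proof (rule ccontr)
    assume disconn: "\<not> ?thesis"
    have "verts \<Gamma> - S \<noteq> {}"
      using S card4 by auto
    then obtain A B where AB: "A \<union> B = verts \<Gamma> - S" "A \<inter> B = {}" "A \<noteq> {}" "B \<noteq> {}"
      "\<And>a b. \<lbrakk>a \<in> A; b \<in> B\<rbrakk> \<Longrightarrow> \<not> a \<rightarrow>\<^bsub>\<Gamma>\<^esub> b"
      using G.disconnected_induce_subgraph[OF Diff_subset _ disconn] by metis
    have "G.walk_dist a b \<noteq> 1" if "a \<in> A" "b \<in> B" for a b
      using AB(1) AB(5)[OF that] adj[of a b] that by blast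
    then have sep: "M.separates S A B"
      using S(1) AB(1-4) unfolding M.separates_def by blast
    \<comment> \<open>The empty \<open>S\<close> expresses connectedness of the graph itself and is
      refuted by \<open>separator_nbr\<close>.\<close>
    consider "card S = 0" | "card S = 1" | "card S = 2" using S(2) by linarith
    then show False
    proof cases
      case 1
      then have "S = {}" using finite_subset[OF S(1)] by simp
      then show False using M.separator_nbr[OF sep] by simp
    next
      case 2
      then obtain y where "S = {y}" by (rule card_1_singletonE)
      then show False using M.no_cut_vertex sep by simp
    next
      case 3
      then obtain x y where "S = {x, y}" "x \<noteq> y" by (auto simp: card_2_iff)
      then show False using M.no_two_separator[of x y A B] sep deg[of x] S(1) by simp
    qed
  qed
  ultimately show ?thesis by (simp add: three_connected_def)
qed

end
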